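(* Let $\Bbbk$ be a field of characteristic $0$, $V$ an $n$-dimensional $\Bbbk$-vector space, $x\in\mathrm{Alg}(V)$ and $V_x=(V,\mu_x)$. Then the Zariski tangent space of the scheme $\mathrm{Alg}(V)$ at $x$ coincides with the incidence fiber $F_x$ and with the space of Hochschild $2$-cocycles: $$T_x\mathrm{Alg}(V)=F_x=Z^2(V_x,V_x)$$ as subspaces of $V^{2,1}=\mathrm{Hom}(V\otimes V,V)$.
   Context: Fix a basis $(e_i)_{i=1}^n$ of $V$. Each $x\in V^{2,1}\cong\Bbbk^{n^3}$ has structure constants $x_{i,j}^\ell$ and determines the bilinear product $\mu_x(e_i,e_j)=\sum_{\ell} x_{i,j}^\ell e_\ell$. Let $V^{3,1}=\mathrm{Hom}(V^{\otimes 3},V)$. $\mathrm{Alg}(V)=\{x\in V^{2,1}:\Phi(x)=0\}$ with $\Phi(x)(a,b,c)=\mu_x(\mu_x(a,b),c)-\mu_x(a,\mu_x(b,c))$, regarded as the closed subscheme of $V^{2,1}$ cut out by the $n^4$ quadratic polynomials $\sum_{\ell}x_{i,j}^{\ell}x_{\ell,k}^m-\sum_{\ell}x_{i,\ell}^m x_{j,k}^{\ell}$. Let $\beta(x,y)(a,b,c)=\mu_x(\mu_y(a,b),c)-\mu_x(a,\mu_y(b,c))$. For $\varphi\in (V^{3,1})^\vee$ let $q_\varphi$ be the $n^3\times n^3$ matrix with $\langle\varphi,\beta(x,y)\rangle=x^{t}q_\varphi y$ for all $x,y$ (column vectors of structure constants). Let $Q_{\mathrm{As}}$ be the span of all $q_\varphi$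 and $Q_{\mathrm{As}}^{\mathrm{sym}}=\mathrm{span}\{\tfrac12(q+q^{t}):q\in Q_{\mathrm{As}}\}$. The incidence fiber at $x$ is $$F_x=\{y\in V^{2,1}:x^{t}qy=0\text{ for all }q\in Q_{\mathrm{As}}^{\mathrm{sym}}\}.$$ $Z^2(V_x,V_x)$ is the kernel of the Hochschild differential $d_{\mu_x}:C^2\to C^3$, $C^p=\mathrm{Hom}(V^{\otimes p},V)$; equivalently (up to sign of the differential) the space of $y\in V^{2,1}$ with $\mu_x(y(a,b),c)-\mu_x(a,y(b,c))+y(\mu_x(a,b),c)-y(a,\mu_x(b,c))=0$ for all $a,b,c\in V$. *)

theory Defs
  imports Complex_Main "HOL-Library.Poly_Mapping" "HOL-Library.Function_Algebras"
begin

text \<open>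
  Structure constants $x_{i,j}^\ell$ are indexed by triples \<open>(i, j, \<ell>)\<close>, with all indices
  running over \<open>{..<n}\<close> instead of $1, \dots, n$.
\<close>

type_synonym idx3 = "nat \<times> nat \<times> nat"

definition idx :: "nat \<Rightarrow> idx3 set"
  where "idx n = {..<n} \<times> {..<n} \<times> {..<n}"

text \<open>
  A polynomial is a finitely supported family of coefficients indexed by monomials, and a monomial
  is a finitely supported family of exponents indexed by variables.  The coordinate ring of
  $V^{2,1}$ consists of those polynomials that only involve the $n^3$ variables in \<open>idx n\<close>.
\<close>

type_synonym 'k mpoly3 = "(idx3 \<Rightarrow>\<^sub>0 nat) \<Rightarrow>\<^sub>0 'k"

definition pring :: "nat \<Rightarrow> 'k::field mpoly3 set"
  where "pring n = {p. \<forall>m \<in> Poly_Mapping.keys p. Poly_Mapping.keys m \<subseteq> idx n}"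

definition pconst :: "'k::field \<Rightarrow> 'k mpoly3"
  where "pconst c = Poly_Mapping.single 0 c"

definition pvar :: "idx3 \<Rightarrow> 'k::field mpoly3"
  where "pvar v = Poly_Mapping.single (Poly_Mapping.single v 1) 1"

definition peval :: "(idx3 \<Rightarrow> 'k::field) \<Rightarrow> 'k mpoly3 \<Rightarrow> 'k"
  where "peval a p = (\<Sum>m \<in> Poly_Mapping.keys p. Poly_Mapping.lookup p m *
           (\<Prod>v \<in> Poly_Mapping.keys m. a v ^ Poly_Mapping.lookup m v))"

text \<open>The $n^4$ quadrics cutting out $\mathrm{Alg}(V)$, and the ideal they generate.\<close>

definition alg_eqn :: "nat \<Rightarrow> nat \<Rightarrow> nat \<Rightarrow> nat \<Rightarrow> nat \<Rightarrow> 'k::field mpoly3"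
  where "alg_eqn n i j k m =
           (\<Sum>l<n. pvar (i, j, l) * pvar (l, k, m)) - (\<Sum>l<n. pvar (i, l, m) * pvar (j, k, l))"

definition alg_eqns :: "nat \<Rightarrow> 'k::field mpoly3 set"
  where "alg_eqns n = {alg_eqn n i j k m | i j k m. i < n \<and> j < n \<and> k < n \<and> m < n}"

definition alg_ideal :: "nat \<Rightarrow> 'k::field mpoly3 set"
  where "alg_ideal n = {\<Sum>g\<in>alg_eqns n. c g * g | c. \<forall>g \<in> alg_eqns n. c g \<in> pring n}"

text \<open>
  Let $A = \Bbbk[X]/I$ be the coordinate ring of the scheme and let \<open>a\<close> be a rational point of it.
  The maximal ideal $\mathfrak m$ of $A$ at \<open>a\<close> is the quotient by $I$ of the ideal
  \<open>point_ideal n a\<close> of $\Bbbk[X]$.  The Zariski tangent space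
  $(\mathfrak m/\mathfrak m^2)^\vee$ (the same for $A$ and for its localization at
  $\mathfrak m$) thus consists of the linear functionals on \<open>point_ideal n a\<close> that vanish on $I$
  and on all products of two elements of \<open>point_ideal n a\<close>.  Values of these functionals outside
  \<open>point_ideal n a\<close> are irrelevant.
\<close>

definition point_ideal :: "nat \<Rightarrow> (idx3 \<Rightarrow> 'k::field) \<Rightarrow> 'k mpoly3 set"
  where "point_ideal n a = {f \<in> pring n. peval a f = 0}"

definition cotangent_dual :: "nat \<Rightarrow> (idx3 \<Rightarrow> 'k::field) \<Rightarrow> ('k mpoly3 \<Rightarrow> 'k) set"
  where "cotangent_dual n a = {t.
           (\<forall>f \<in> point_ideal n a. \<forall>g \<in> point_ideal n a. \<forall>c d.
              t (pconst c * f + pconst d * g) = c * t f + d * t g) \<and>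
           (\<forall>f \<in> alg_ideal n. t f = 0) \<and>
           (\<forall>f \<in> point_ideal n a. \<forall>g \<in> point_ideal n a. t (f * g) = 0)}"

locale based_vector_space = vector_space scale
  for scale :: "'k::field_char_0 \<Rightarrow> 'v::ab_group_add \<Rightarrow> 'v" +
  fixes n :: nat and e :: "nat \<Rightarrow> 'v"
  assumes inj_basis: "inj_on e {..<n}"
    and independent_basis: "independent (e ` {..<n})"
    and span_basis: "span (e ` {..<n}) = UNIV"
begin

text \<open>
  $V^{2,1} = \mathrm{Hom}(V^{\otimes 2}, V)$ and $V^{3,1} = \mathrm{Hom}(V^{\otimes 3}, V)$ as
  spaces of bilinear and trilinear maps; an element \<open>x\<close> of \<open>V21\<close> is its own product $\mu_x$.
\<close>

definition V21 :: "('v \<Rightarrow> 'v \<Rightarrow> 'v) set"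
  where "V21 = {x. (\<forall>b. Vector_Spaces.linear scale scale (\<lambda>a. x a b)) \<and>
                   (\<forall>a. Vector_Spaces.linear scale scale (\<lambda>b. x a b))}"

definition V31 :: "('v \<Rightarrow> 'v \<Rightarrow> 'v \<Rightarrow> 'v) set"
  where "V31 = {f. (\<forall>b c. Vector_Spaces.linear scale scale (\<lambda>a. f a b c)) \<and>
                   (\<forall>a c. Vector_Spaces.linear scale scale (\<lambda>b. f a b c)) \<and>
                   (\<forall>a b. Vector_Spaces.linear scale scale (\<lambda>c. f a b c))}"

definition V31_dual :: "(('v \<Rightarrow> 'v \<Rightarrow> 'v \<Rightarrow> 'v) \<Rightarrow> 'k) set"
  where "V31_dual = {\<phi>. \<forall>f \<in> V31. \<forall>g \<in> V31. \<forall>s t.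
           \<phi> (\<lambda>a b c. scale s (f a b c) + scale t (g a b c)) = s * \<phi> f + t * \<phi> g}"

definition sconst :: "('v \<Rightarrow> 'v \<Rightarrow> 'v) \<Rightarrow> idx3 \<Rightarrow> 'k"
  where "sconst x = (\<lambda>(i, j, l). representation (e ` {..<n}) (x (e i) (e j)) (e l))"

definition Phi :: "('v \<Rightarrow> 'v \<Rightarrow> 'v) \<Rightarrow> 'v \<Rightarrow> 'v \<Rightarrow> 'v \<Rightarrow> 'v"
  where "Phi x a b c = x (x a b) c - x a (x b c)"

definition Alg :: "('v \<Rightarrow> 'v \<Rightarrow> 'v) set"
  where "Alg = {x \<in> V21. \<forall>a b c. Phi x a b c = 0}"

text \<open>
  A tangent vector \<open>t\<close> at \<open>x\<close> is regarded as an element of the ambient space $V^{2,1}$ through its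
  coordinates, the values of \<open>t\<close> on the elements $X_v - x_v$ of the maximal ideal.
\<close>

definition tangent_space :: "('v \<Rightarrow> 'v \<Rightarrow> 'v) \<Rightarrow> ('v \<Rightarrow> 'v \<Rightarrow> 'v) set"
  where "tangent_space x = {y \<in> V21. \<exists>t \<in> cotangent_dual n (sconst x).
           \<forall>v \<in> idx n. sconst y v = t (pvar v - pconst (sconst x v))}"

definition beta ::
    "('v \<Rightarrow> 'v \<Rightarrow> 'v) \<Rightarrow> ('v \<Rightarrow> 'v \<Rightarrow> 'v) \<Rightarrow> 'v \<Rightarrow> 'v \<Rightarrow> 'v \<Rightarrow> 'v"
  where "beta x y a b c = x (y a b) c - x a (y b c)"

text \<open>
  Matrices of size $n^3 \times n^3$ are functions that vanish outside \<open>idx n \<times> idx n\<close>;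
  \<open>mform q x y\<close> is $x^t q y$.
\<close>

definition mform ::
    "(idx3 \<Rightarrow> idx3 \<Rightarrow> 'k) \<Rightarrow> ('v \<Rightarrow> 'v \<Rightarrow> 'v) \<Rightarrow> ('v \<Rightarrow> 'v \<Rightarrow> 'v) \<Rightarrow> 'k"
  where "mform q x y = (\<Sum>u\<in>idx n. \<Sum>v\<in>idx n. sconst x u * q u v * sconst y v)"

definition is_q :: "(('v \<Rightarrow> 'v \<Rightarrow> 'v \<Rightarrow> 'v) \<Rightarrow> 'k) \<Rightarrow> (idx3 \<Rightarrow> idx3 \<Rightarrow> 'k) \<Rightarrow> bool"
  where "is_q \<phi> q \<longleftrightarrow>
           (\<forall>u v. u \<notin> idx n \<or> v \<notin> idx n \<longrightarrow> q u v = 0) \<and>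
           (\<forall>x \<in> V21. \<forall>y \<in> V21. \<phi> (beta x y) = mform q x y)"

definition mspan :: "(idx3 \<Rightarrow> idx3 \<Rightarrow> 'k) set \<Rightarrow> (idx3 \<Rightarrow> idx3 \<Rightarrow> 'k) set"
  where "mspan = module.span (\<lambda>c q u v. c * q u v)"

definition Q_As :: "(idx3 \<Rightarrow> idx3 \<Rightarrow> 'k) set"
  where "Q_As = mspan {q. \<exists>\<phi> \<in> V31_dual. is_q \<phi> q}"

definition Q_As_sym :: "(idx3 \<Rightarrow> idx3 \<Rightarrow> 'k) set"
  where "Q_As_sym = mspan {(\<lambda>u v. 1 / 2 * (q u v + q v u)) | q. q \<in> Q_As}"

definition incidence_fiber :: "('v \<Rightarrow> 'v \<Rightarrow> 'v) \<Rightarrow> ('v \<Rightarrow> 'v \<Rightarrow> 'v) set"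
  where "incidence_fiber x = {y \<in> V21. \<forall>q \<in> Q_As_sym. mform q x y = 0}"

definition hochschild_d2 ::
    "('v \<Rightarrow> 'v \<Rightarrow> 'v) \<Rightarrow> ('v \<Rightarrow> 'v \<Rightarrow> 'v) \<Rightarrow> 'v \<Rightarrow> 'v \<Rightarrow> 'v \<Rightarrow> 'v"
  where "hochschild_d2 x y a b c = x a (y b c) - y (x a b) c + y a (x b c) - x (y a b) c"

definition Z2 :: "('v \<Rightarrow> 'v \<Rightarrow> 'v) \<Rightarrow> ('v \<Rightarrow> 'v \<Rightarrow> 'v) set"
  where "Z2 x = {y \<in> V21. \<forall>a b c. hochschild_d2 x y a b c = 0}"

end

end

theory Submission
  imports Defs "HOL-Computational_Algebra.Polynomial"
begin

text \<open>
  Write \<open>a\<close>, \<open>d\<close> for the structure constants of \<open>x\<close>, \<open>y\<close>.  Each of the three spaces is cut out by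
  the polarizations \<open>B(a, d) + B(d, a) = 0\<close> of the $n^4$ quadrics $B(a, a)$: for cocycles because
  the Hochschild differential is $-(\beta(x,y) + \beta(y,x))$, for the incidence fiber because the
  coordinates of $V^{3,1}$ span its dual.  For the tangent space, a functional on the maximal ideal
  is evaluated on the Taylor expansion of the quadrics at \<open>a\<close>; conversely, a solution \<open>d\<close> yields
  the functional sending \<open>f\<close> to the linear coefficient of \<open>f(a + dT)\<close>.
\<close>

section \<open>Evaluation of polynomials\<close>

text \<open>A finitely supported map is the finite sum of its single terms, so an identity additive
  in a polynomial only has to be checked on monomials.\<close>

lemma poly_mapping_add_induct [case_names zero single add]:
  fixes p :: "'a \<Rightarrow>\<^sub>0 'b::comm_monoid_add"
  assumes "P 0" and "\<And>k c. P (Poly_Mapping.single k c)" and "\<And>p q. P p \<Longrightarrow> P q \<Longrightarrow> P (p + q)"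
  shows "P p"
proof -
  have "P (\<Sum>k\<in>A. Poly_Mapping.single k (Poly_Mapping.lookup p k))" if "finite A" for A
    using that by induction (use assms in auto)
  moreover have "(\<Sum>k\<in>Poly_Mapping.keys p. Poly_Mapping.single k (Poly_Mapping.lookup p k)) = p"
    by (rule poly_mapping_eqI) (auto simp: lookup_sum lookup_single when_def in_keys_iff)
  ultimately show ?thesis
    by (metis finite_keys)
qed

definition monom_eval :: "('a \<Rightarrow> 'r) \<Rightarrow> ('a \<Rightarrow>\<^sub>0 nat) \<Rightarrow> 'r::comm_ring_1"
  where "monom_eval b m = (\<Prod>v\<in>Poly_Mapping.keys m. b v ^ Poly_Mapping.lookup m v)"

text \<open>Coefficients pass through \<open>h\<close> into a second ring. Evaluation in the field
  and substitution of one-variable polynomials are then instances of one construction.\<close>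

definition mpoly_eval ::
    "('k::comm_ring_1 \<Rightarrow> 'r) \<Rightarrow> ('a \<Rightarrow> 'r) \<Rightarrow> (('a \<Rightarrow>\<^sub>0 nat) \<Rightarrow>\<^sub>0 'k) \<Rightarrow> 'r::comm_ring_1"
  where "mpoly_eval h b p =
           (\<Sum>m\<in>Poly_Mapping.keys p. h (Poly_Mapping.lookup p m) * monom_eval b m)"

text \<open>Variables outside the support have exponent 0 and contribute the factor 1; this allows
  several monomials to be compared over one common set of variables.\<close>

lemma monom_eval_superset:
  assumes "finite S" "Poly_Mapping.keys m \<subseteq> S"
  shows "monom_eval b m = (\<Prod>v\<in>S. b v ^ Poly_Mapping.lookup m v)"
  unfolding monom_eval_def
  by (rule prod.mono_neutral_left) (use assms in \<open>auto simp: in_keys_iff\<close>)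

lemma monom_eval_add: "monom_eval b (m + m') = monom_eval b m * monom_eval b m'"
proof -
  let ?S = "Poly_Mapping.keys m \<union> Poly_Mapping.keys m'"
  have "Poly_Mapping.keys (m + m') \<subseteq> ?S"
    by (rule keys_add)
  then show ?thesis
    by (simp add: monom_eval_superset[of ?S] lookup_add power_add prod.distrib)
qed

locale coeff_hom =
  fixes h :: "'k::comm_ring_1 \<Rightarrow> 'r::comm_ring_1"
  assumes h_add: "h (c + d) = h c + h d" and h_mult: "h (c * d) = h c * h d" and h_1: "h 1 = 1"
begin

lemma h_0: "h 0 = 0"
  using h_add[of 0 0] by simp

lemma mpoly_eval_add: "mpoly_eval h b (p + q) = mpoly_eval h b p + mpoly_eval h b q"
  unfolding mpoly_eval_def
  by (rule setsum_keys_plus_distrib) (simp_all add: h_0 h_add algebra_simps)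

lemma mpoly_eval_0: "mpoly_eval h b 0 = 0"
  by (simp add: mpoly_eval_def)

lemma mpoly_eval_single: "mpoly_eval h b (Poly_Mapping.single m c) = h c * monom_eval b m"
  by (simp add: mpoly_eval_def h_0)

text \<open>Both sides are additive in \<open>p\<close> and in \<open>q\<close>, which leaves
  products of two single terms; there exponents add and \<open>h\<close> is multiplicative.\<close>

lemma mpoly_eval_mult: "mpoly_eval h b (p * q) = mpoly_eval h b p * mpoly_eval h b q"
proof (induction p rule: poly_mapping_add_induct)
  case (single k c)
  show ?case
    by (induction q rule: poly_mapping_add_induct)
      (simp_all add: mpoly_eval_0 mpoly_eval_single mult_single monom_eval_add h_mult
        mpoly_eval_add algebra_simps)
qed (simp_all add: mpoly_eval_0 mpoly_eval_add algebra_simps)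

lemma mpoly_eval_diff: "mpoly_eval h b (p - q) = mpoly_eval h b p - mpoly_eval h b q"
  using mpoly_eval_add[of b "p - q" q] by simp

lemma mpoly_eval_sum: "mpoly_eval h b (sum f A) = (\<Sum>i\<in>A. mpoly_eval h b (f i))"
  by (induction A rule: infinite_finite_induct) (simp_all add: mpoly_eval_0 mpoly_eval_add)

end

lemma mpoly_eval_pvar:
  assumes "coeff_hom h"
  shows "mpoly_eval h b (pvar v) = b v"
  by (simp add: pvar_def coeff_hom.mpoly_eval_single[OF assms] coeff_hom.h_1[OF assms]
      monom_eval_def)

lemma mpoly_eval_pconst:
  assumes "coeff_hom h"
  shows "mpoly_eval h b (pconst c) = h c"
  by (simp add: pconst_def coeff_hom.mpoly_eval_single[OF assms] monom_eval_def)

section \<open>Evaluation at a point and along a line\<close>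

lemma coeff_hom_id: "coeff_hom (\<lambda>c. c)"
  by unfold_locales auto

lemma coeff_hom_const_poly: "coeff_hom (\<lambda>c. [:c:])"
  by unfold_locales (auto simp: one_pCons)

lemma peval_eq_mpoly_eval: "peval a = mpoly_eval (\<lambda>c. c) a"
  by (simp add: fun_eq_iff peval_def mpoly_eval_def monom_eval_def)

text \<open>Restriction to the affine line a + dT: \<open>[:a v, d v:]\<close> is the polynomial a_v
  + d_v T in the parameter T.\<close>

definition line_eval :: "(idx3 \<Rightarrow> 'k::field) \<Rightarrow> (idx3 \<Rightarrow> 'k) \<Rightarrow> 'k mpoly3 \<Rightarrow> 'k poly"
  where "line_eval a d = mpoly_eval (\<lambda>c. [:c:]) (\<lambda>v. [:a v, d v:])"

text \<open>The derivative at \<open>a\<close> in the direction \<open>d\<close>, read off as the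
  coefficient of T instead of being assembled from partial derivatives.\<close>

definition dir_deriv :: "(idx3 \<Rightarrow> 'k::field) \<Rightarrow> (idx3 \<Rightarrow> 'k) \<Rightarrow> 'k mpoly3 \<Rightarrow> 'k"
  where "dir_deriv a d f = coeff (line_eval a d f) 1"

text \<open>Setting T = 0 turns the line into the point \<open>a\<close>.\<close>

lemma coeff_line_eval_0: "coeff (line_eval a d f) 0 = peval a f"
  by (simp add: line_eval_def peval_eq_mpoly_eval mpoly_eval_def monom_eval_def
      poly_sum poly_prod poly_power flip: poly_0_coeff_0)

lemmas line_eval_simps =
  coeff_hom.mpoly_eval_add[OF coeff_hom_const_poly] coeff_hom.mpoly_eval_mult[OF coeff_hom_const_poly]
  coeff_hom.mpoly_eval_diff[OF coeff_hom_const_poly] coeff_hom.mpoly_eval_sum[OF coeff_hom_const_poly]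
  mpoly_eval_pvar[OF coeff_hom_const_poly] mpoly_eval_pconst[OF coeff_hom_const_poly]

lemmas peval_simps =
  coeff_hom.mpoly_eval_add[OF coeff_hom_id] coeff_hom.mpoly_eval_mult[OF coeff_hom_id]
  coeff_hom.mpoly_eval_diff[OF coeff_hom_id] coeff_hom.mpoly_eval_sum[OF coeff_hom_id]
  mpoly_eval_pvar[OF coeff_hom_id] mpoly_eval_pconst[OF coeff_hom_id]

lemma dir_deriv_add: "dir_deriv a d (f + g) = dir_deriv a d f + dir_deriv a d g"
  by (simp add: dir_deriv_def line_eval_def line_eval_simps)

lemma dir_deriv_diff: "dir_deriv a d (f - g) = dir_deriv a d f - dir_deriv a d g"
  by (simp add: dir_deriv_def line_eval_def line_eval_simps)

lemma dir_deriv_sum: "dir_deriv a d (sum f A) = (\<Sum>i\<in>A. dir_deriv a d (f i))"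
  by (simp add: dir_deriv_def line_eval_def line_eval_simps coeff_sum)

text \<open>The Leibniz rule is the formula for the linear coefficient of a product of one-variable
  polynomials, whose constant coefficients are the values at \<open>a\<close>.\<close>

lemma dir_deriv_mult: "dir_deriv a d (f * g) = dir_deriv a d f * peval a g + peval a f * dir_deriv a d g"
proof -
  have "line_eval a d (f * g) = line_eval a d f * line_eval a d g"
    by (simp add: line_eval_def line_eval_simps)
  then show ?thesis
    by (simp add: dir_deriv_def coeff_mult coeff_line_eval_0)
qed

lemma dir_deriv_pconst: "dir_deriv a d (pconst c) = 0"
  by (simp add: dir_deriv_def line_eval_def line_eval_simps)

lemma dir_deriv_pvar: "dir_deriv a d (pvar v) = d v"
  by (simp add: dir_deriv_def line_eval_def line_eval_simps)

section \<open>The coordinate ring and the maximal ideal of a point\<close>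

lemma pring_add: "f \<in> pring n \<Longrightarrow> g \<in> pring n \<Longrightarrow> f + g \<in> pring n"
  using keys_add[of f g] by (auto simp: pring_def)

lemma pring_mult:
  assumes "f \<in> pring n" "g \<in> pring n"
  shows "f * g \<in> pring n"
proof -
  have "Poly_Mapping.keys m \<subseteq> idx n" if m: "m \<in> Poly_Mapping.keys (f * g)" for m
  proof -
    obtain m1 m2 where "m = m1 + m2" "m1 \<in> Poly_Mapping.keys f" "m2 \<in> Poly_Mapping.keys g"
      using m keys_mult[of f g] by blast
    then show ?thesis
      using keys_add[of m1 m2] assms unfolding pring_def by blast
  qed
  then show ?thesis by (simp add: pring_def)
qed

lemma pring_pconst: "pconst c \<in> pring n"
  by (simp add: pring_def pconst_def)

lemma pring_pvar: "v \<in> idx n \<Longrightarrow> pvar v \<in> pring n"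
  by (simp add: pring_def pvar_def)

lemma pconst_add: "pconst (c + d) = pconst c + pconst d"
  by (simp add: pconst_def single_add)

lemma pconst_diff: "pconst (c - d) = pconst c - pconst d"
  by (simp add: pconst_def single_diff)

lemma pconst_minus: "pconst (- c) = - pconst c"
  by (simp add: pconst_def single_uminus)

lemma pconst_mult: "pconst (c * d) = pconst c * pconst d"
  by (simp add: pconst_def mult_single)

lemma pconst_0 [simp]: "pconst 0 = 0"
  by (simp add: pconst_def)

lemma pconst_1 [simp]: "pconst 1 = 1"
  by (simp add: pconst_def)

lemma pconst_sum: "pconst (sum f A) = (\<Sum>i\<in>A. pconst (f i))"
  by (induction A rule: infinite_finite_induct) (simp_all add: pconst_add)

lemma point_ideal_add: "f \<in> point_ideal n a \<Longrightarrow> g \<in> point_ideal n a \<Longrightarrow> f + g \<in> point_ideal n a"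
  by (simp add: point_ideal_def pring_add peval_eq_mpoly_eval peval_simps)

lemma point_ideal_mult: "f \<in> pring n \<Longrightarrow> g \<in> point_ideal n a \<Longrightarrow> f * g \<in> point_ideal n a"
  by (simp add: point_ideal_def pring_mult peval_eq_mpoly_eval peval_simps)

lemma point_ideal_diff:
  assumes f: "f \<in> point_ideal n a" and g: "g \<in> point_ideal n a"
  shows "f - g \<in> point_ideal n a"
  using point_ideal_add[OF f point_ideal_mult[OF pring_pconst[of "-1"] g]]
  by (simp add: pconst_minus)

lemma point_ideal_0: "0 \<in> point_ideal n a"
  by (simp add: point_ideal_def pring_def peval_def)

lemma point_ideal_sum: "(\<And>i. i \<in> A \<Longrightarrow> f i \<in> point_ideal n a) \<Longrightarrow> sum f A \<in> point_ideal n a"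
  by (induction A rule: infinite_finite_induct) (simp_all add: point_ideal_add point_ideal_0)

text \<open>The coordinate functions centred at \<open>a\<close>; the values of a tangent functional
  on them are the coordinates of the tangent vector.\<close>

definition shifted_var :: "(idx3 \<Rightarrow> 'k::field) \<Rightarrow> idx3 \<Rightarrow> 'k mpoly3"
  where "shifted_var a v = pvar v - pconst (a v)"

lemma shifted_var_pring: "v \<in> idx n \<Longrightarrow> shifted_var a v \<in> pring n"
  using pring_add[OF pring_pvar pring_pconst[of "- a v"]]
  by (simp add: shifted_var_def pconst_minus)

lemma shifted_var_point_ideal: "v \<in> idx n \<Longrightarrow> shifted_var a v \<in> point_ideal n a"
  by (simp add: point_ideal_def shifted_var_pring)
    (simp add: shifted_var_def peval_eq_mpoly_eval peval_simps)

section \<open>Tangent functionals on the maximal ideal\<close>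

context
  fixes t :: "'k::field mpoly3 \<Rightarrow> 'k" and n a
  assumes t: "t \<in> cotangent_dual n a"
begin

lemma cotangent_add:
  "f \<in> point_ideal n a \<Longrightarrow> g \<in> point_ideal n a \<Longrightarrow> t (f + g) = t f + t g"
proof -
  assume "f \<in> point_ideal n a" "g \<in> point_ideal n a"
  then have "t (pconst 1 * f + pconst 1 * g) = 1 * t f + 1 * t g"
    using t unfolding cotangent_dual_def by blast
  then show ?thesis by simp
qed

lemma cotangent_scale: "f \<in> point_ideal n a \<Longrightarrow> t (pconst c * f) = c * t f"
proof -
  assume f: "f \<in> point_ideal n a"
  then have "t (pconst c * f + pconst 0 * f) = c * t f + 0 * t f"
    using t unfolding cotangent_dual_def by blast
  then show ?thesis by simp
qed

lemma cotangent_mult: "f \<in> point_ideal n a \<Longrightarrow> g \<in> point_ideal n a \<Longrightarrow> t (f * g) = 0"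
  using t unfolding cotangent_dual_def by blast

lemma cotangent_0: "t 0 = 0"
  using cotangent_scale[OF point_ideal_0, of 0] by simp

lemma cotangent_diff:
  "f \<in> point_ideal n a \<Longrightarrow> g \<in> point_ideal n a \<Longrightarrow> t (f - g) = t f - t g"
proof -
  assume f: "f \<in> point_ideal n a" and g: "g \<in> point_ideal n a"
  have "t (f + pconst (-1) * g) = t f + t (pconst (-1) * g)"
    by (rule cotangent_add[OF f point_ideal_mult[OF pring_pconst g]])
  then show ?thesis
    using cotangent_scale[OF g, of "-1"] by (simp add: pconst_minus)
qed

lemma cotangent_sum:
  "(\<And>i. i \<in> A \<Longrightarrow> f i \<in> point_ideal n a) \<Longrightarrow> t (sum f A) = (\<Sum>i\<in>A. t (f i))"
  by (induction A rule: infinite_finite_induct)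
    (simp_all add: cotangent_0 cotangent_add point_ideal_sum)

end

section \<open>The polarized quadrics\<close>

text \<open>The bilinear form B whose diagonal is the associativity quadric: \<open>a\<close> holds
  the constants of the outer product, \<open>d\<close> those of the inner one. Entries from any
  commutative ring are allowed, so that polynomials can be inserted as well as scalars.\<close>

definition bform :: "nat \<Rightarrow> (idx3 \<Rightarrow> 'k::comm_ring) \<Rightarrow> (idx3 \<Rightarrow> 'k) \<Rightarrow> nat \<Rightarrow> nat \<Rightarrow> nat \<Rightarrow> nat \<Rightarrow> 'k"
  where "bform n a d i j k m =
           (\<Sum>l<n. a (l, k, m) * d (i, j, l)) - (\<Sum>l<n. a (i, l, m) * d (j, k, l))"

lemma peval_alg_eqn: "peval a (alg_eqn n i j k m) = bform n a a i j k m"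
  by (simp add: alg_eqn_def bform_def peval_eq_mpoly_eval peval_simps mult.commute)

text \<open>The Leibniz rule differentiates the two factors of B(X, X) in turn, which produces the
  polarization.\<close>

lemma dir_deriv_alg_eqn:
  "dir_deriv a d (alg_eqn n i j k m) = bform n a d i j k m + bform n d a i j k m"
  by (simp add: alg_eqn_def bform_def dir_deriv_diff dir_deriv_sum dir_deriv_mult dir_deriv_pvar
      peval_eq_mpoly_eval peval_simps sum.distrib algebra_simps)

lemma finite_alg_eqns: "finite (alg_eqns n)"
proof -
  have "alg_eqns n \<subseteq> (\<lambda>(i, j, k, m). alg_eqn n i j k m) ` ({..<n} \<times> {..<n} \<times> {..<n} \<times> {..<n})"
    unfolding alg_eqns_def by force
  then show ?thesis
    by (rule finite_subset) simp
qed

lemma alg_eqns_subset_alg_ideal: "alg_eqns n \<subseteq> alg_ideal n"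
proof
  fix g :: "'a mpoly3" assume g: "g \<in> alg_eqns n"
  \<comment> \<open>Elements of the ideal are combinations of all generators at once, so
    \<open>g\<close> receives the coefficient 1 and every other generator 0.\<close>
  define c where "c g' = (if g' = g then 1 else 0 :: 'a mpoly3)" for g'
  have "(\<Sum>g'\<in>alg_eqns n. c g' * g') = (\<Sum>g'\<in>alg_eqns n. if g' = g then g' else 0)"
    by (rule sum.cong) (auto simp: c_def)
  then have "g = (\<Sum>g'\<in>alg_eqns n. c g' * g')"
    using g by (simp add: finite_alg_eqns)
  moreover have "\<forall>g'\<in>alg_eqns n. c g' \<in> pring n"
    using pring_pconst[of "1 :: 'a" n] pring_pconst[of "0 :: 'a" n] by (simp add: c_def)
  ultimately show "g \<in> alg_ideal n"
    unfolding alg_ideal_def by blast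
qed

lemma alg_eqn_in_alg_ideal:
  "i < n \<Longrightarrow> j < n \<Longrightarrow> k < n \<Longrightarrow> m < n \<Longrightarrow> alg_eqn n i j k m \<in> alg_ideal n"
  using alg_eqns_subset_alg_ideal[of n] unfolding alg_eqns_def by blast

lemma bform_add_same:
  "bform n (\<lambda>v. a v + d v) (\<lambda>v. a v + d v) i j k m =
    bform n a a i j k m + (bform n a d i j k m + bform n d a i j k m) + bform n d d i j k m"
  by (simp add: bform_def algebra_simps sum.distrib)

lemma pconst_bform:
  "pconst (bform n a d i j k m) = bform n (\<lambda>v. pconst (a v)) (\<lambda>v. pconst (d v)) i j k m"
  by (simp add: bform_def pconst_diff pconst_sum pconst_mult)

text \<open>Writing X_v = a_v + (X_v - a_v) and expanding B over the polynomial ring splits the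
  quadric into its parts of order 0, 1 and 2 at \<open>a\<close>.\<close>

lemma alg_eqn_taylor:
  "alg_eqn n i j k m = pconst (bform n a a i j k m)
     + (bform n (\<lambda>v. pconst (a v)) (shifted_var a) i j k m
        + bform n (shifted_var a) (\<lambda>v. pconst (a v)) i j k m)
     + bform n (shifted_var a) (shifted_var a) i j k m"
proof -
  have "alg_eqn n i j k m = bform n pvar pvar i j k m"
    by (simp add: alg_eqn_def bform_def mult.commute)
  also have "\<dots> = bform n (\<lambda>v. pconst (a v) + shifted_var a v)
      (\<lambda>v. pconst (a v) + shifted_var a v) i j k m"
    by (simp add: shifted_var_def)
  finally show ?thesis
    by (simp only: bform_add_same pconst_bform)
qed

text \<open>Apply \<open>t\<close> to the Taylor expansion of the quadric. The quadric lies in the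
  ideal, so the result is 0; the constant part vanishes because \<open>a\<close> is a point of the
  scheme, the quadratic part consists of products of two elements of the maximal ideal, and the
  linear part yields the polarization.\<close>

lemma cotangent_dual_bform:
  assumes t: "t \<in> cotangent_dual n a" and alg: "bform n a a i j k m = 0"
    and [simp]: "i < n" "j < n" "k < n" "m < n"
    and d: "\<And>v. v \<in> idx n \<Longrightarrow> d v = t (shifted_var a v)"
  shows "bform n a d i j k m + bform n d a i j k m = 0"
proof -
  let ?c = "\<lambda>v. pconst (a v)" and ?s = "shifted_var a"
  have [simp]: "(p, q, r) \<in> idx n" if "p < n" "q < n" "r < n" for p q r
    using that by (simp add: idx_def)
  note mem = shifted_var_point_ideal point_ideal_mult shifted_var_pring pring_pconst
  have lin: "bform n ?c ?s i j k m \<in> point_ideal n a" "bform n ?s ?c i j k m \<in> point_ideal n a"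
    and quad: "bform n ?s ?s i j k m \<in> point_ideal n a"
    \<comment> \<open>Commuting the factors puts the constant on the left, where
      \<open>point_ideal_mult\<close> expects the arbitrary ring element.\<close>
    unfolding bform_def mult.commute[of "?s _" "?c _"]
    by (auto intro!: point_ideal_diff point_ideal_sum mem)
  \<comment> \<open>Linearity of \<open>t\<close> is known on the maximal ideal only, hence the
    membership condition on every summand.\<close>
  have t_diff: "t ((\<Sum>l<n. f l) - (\<Sum>l<n. g l)) = (\<Sum>l<n. t (f l)) - (\<Sum>l<n. t (g l))"
    if "\<And>l. l < n \<Longrightarrow> f l \<in> point_ideal n a" "\<And>l. l < n \<Longrightarrow> g l \<in> point_ideal n a" for f g
    using that cotangent_sum[OF t, of "{..<n}" f] cotangent_sum[OF t, of "{..<n}" g]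
      cotangent_diff[OF t point_ideal_sum[of "{..<n}" f] point_ideal_sum[of "{..<n}" g]]
    by simp
  have "t (bform n ?c ?s i j k m) = bform n a d i j k m"
    unfolding bform_def
    by (subst t_diff) (auto intro!: mem simp: cotangent_scale[OF t] mem d)
  moreover have "t (bform n ?s ?c i j k m) = bform n d a i j k m"
    unfolding bform_def mult.commute[of "?s _" "?c _"] mult.commute[of "d _" "a _"]
    by (subst t_diff) (auto intro!: mem simp: cotangent_scale[OF t] mem d)
  moreover have "t (bform n ?s ?s i j k m) = 0"
    unfolding bform_def
    by (subst t_diff) (auto intro!: mem simp: cotangent_mult[OF t] mem)
  moreover have "t (alg_eqn n i j k m) = 0"
    using t by (simp add: cotangent_dual_def alg_eqn_in_alg_ideal)
  ultimately show ?thesis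
    using lin quad
    by (simp add: alg_eqn_taylor[of n i j k m a] alg cotangent_add[OF t] point_ideal_add)
qed

text \<open>By the Leibniz rule, the derivative of a multiple of a generator involves only the value
  and the derivative of that generator at \<open>a\<close>, which vanish by \<open>alg\<close> and
  \<open>tan\<close>. A product of two functions vanishing at \<open>a\<close> has derivative 0 for
  the same reason.\<close>

lemma dir_deriv_cotangent_dual:
  assumes alg: "\<And>i j k m. i < n \<Longrightarrow> j < n \<Longrightarrow> k < n \<Longrightarrow> m < n \<Longrightarrow> bform n a a i j k m = 0"
    and tan: "\<And>i j k m. i < n \<Longrightarrow> j < n \<Longrightarrow> k < n \<Longrightarrow> m < n \<Longrightarrow>
      bform n a d i j k m + bform n d a i j k m = 0"
  shows "dir_deriv a d \<in> cotangent_dual n a"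
proof -
  have "dir_deriv a d (c * g) = 0" if "g \<in> alg_eqns n" for c g
    using that alg tan
    by (auto simp: alg_eqns_def dir_deriv_mult peval_alg_eqn dir_deriv_alg_eqn)
  then have "dir_deriv a d f = 0" if "f \<in> alg_ideal n" for f
    using that by (auto simp: alg_ideal_def dir_deriv_sum)
  then show ?thesis
    by (auto simp: cotangent_dual_def dir_deriv_add dir_deriv_mult dir_deriv_pconst point_ideal_def
        peval_eq_mpoly_eval peval_simps)
qed

section \<open>Bilinear products and structure constants\<close>

context based_vector_space
begin

definition crd :: "nat \<Rightarrow> 'v \<Rightarrow> 'k"
  where "crd m v = representation (e ` {..<n}) v (e m)"

lemma sconst_eq_crd: "sconst x (i, j, l) = crd l (x (e i) (e j))"
  by (simp add: sconst_def crd_def)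

lemma crd_add: "crd m (u + v) = crd m u + crd m v"
  by (simp add: crd_def representation_add independent_basis span_basis)

lemma crd_diff: "crd m (u - v) = crd m u - crd m v"
  by (simp add: crd_def representation_diff independent_basis span_basis)

lemma crd_scale: "crd m (scale c v) = c * crd m v"
  by (simp add: crd_def representation_scale independent_basis span_basis)

lemma crd_0: "crd m 0 = 0"
  by (simp add: crd_def representation_zero)

lemma crd_sum: "crd m (sum f A) = (\<Sum>i\<in>A. crd m (f i))"
  by (induction A rule: infinite_finite_induct) (simp_all add: crd_0 crd_add)

lemma basis_expansion: "(\<Sum>l<n. scale (crd l v) (e l)) = v"
proof -
  have "(\<Sum>b\<in>e ` {..<n}. scale (representation (e ` {..<n}) v b) b) = v"
    by (rule sum_representation_eq) (auto simp: independent_basis span_basis)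
  then show ?thesis
    by (simp add: sum.reindex[OF inj_basis] crd_def)
qed

lemma crd_eq_0_imp_eq_0:
  assumes "\<And>m. m < n \<Longrightarrow> crd m v = 0"
  shows "v = 0"
  using basis_expansion[of v] assms by simp

lemma linear_expansion:
  assumes "Vector_Spaces.linear scale scale f"
  shows "f v = (\<Sum>l<n. scale (crd l v) (f (e l)))"
proof -
  interpret f: Vector_Spaces.linear scale scale f by fact
  have "f v = f (\<Sum>l<n. scale (crd l v) (e l))"
    by (simp add: basis_expansion)
  then show ?thesis
    by (simp add: f.sum f.scale)
qed

text \<open>The arguments are expanded in the basis one at a time: first \<open>c\<close>, then
  \<open>b\<close>, then \<open>a\<close>.\<close>

lemma trilinear_eq_0:
  assumes "f \<in> V31" and "\<And>i j k. i < n \<Longrightarrow> j < n \<Longrightarrow> k < n \<Longrightarrow> f (e i) (e j) (e k) = 0"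
  shows "f a b c = 0"
proof -
  have lin: "Vector_Spaces.linear scale scale (\<lambda>a. f a b c)"
    "Vector_Spaces.linear scale scale (\<lambda>b. f a b c)"
    "Vector_Spaces.linear scale scale (\<lambda>c. f a b c)" for a b c
    using assms(1) by (auto simp: V31_def)
  have 1: "f (e i) (e j) c = 0" if "i < n" "j < n" for i j c
    by (subst linear_expansion[OF lin(3)]) (simp add: that assms(2))
  have 2: "f (e i) b c = 0" if "i < n" for i b c
    by (subst linear_expansion[OF lin(2)]) (simp add: that 1)
  show ?thesis
    by (subst linear_expansion[OF lin(1)]) (simp add: 2)
qed

section \<open>Multilinear maps and the cocycle condition in coordinates\<close>

lemma V21_iff:
  "x \<in> V21 \<longleftrightarrow> (\<forall>a a' b. x (a + a') b = x a b + x a' b) \<and> (\<forall>r a b. x (scale r a) b = scale r (x a b)) \<and>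
    (\<forall>a b b'. x a (b + b') = x a b + x a b') \<and> (\<forall>r a b. x a (scale r b) = scale r (x a b))"
  unfolding V21_def Vector_Spaces.linear_iff using vector_space_axioms by auto

lemma V31_iff:
  "f \<in> V31 \<longleftrightarrow>
    (\<forall>a a' b c. f (a + a') b c = f a b c + f a' b c) \<and> (\<forall>r a b c. f (scale r a) b c = scale r (f a b c)) \<and>
    (\<forall>a b b' c. f a (b + b') c = f a b c + f a b' c) \<and> (\<forall>r a b c. f a (scale r b) c = scale r (f a b c)) \<and>
    (\<forall>a b c c'. f a b (c + c') = f a b c + f a b c') \<and> (\<forall>r a b c. f a b (scale r c) = scale r (f a b c))"
  unfolding V31_def Vector_Spaces.linear_iff using vector_space_axioms by auto

lemma beta_in_V31: "x \<in> V21 \<Longrightarrow> y \<in> V21 \<Longrightarrow> beta x y \<in> V31"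
  by (simp add: V21_iff V31_iff beta_def scale_right_diff_distrib)

lemma V31_add: "f \<in> V31 \<Longrightarrow> g \<in> V31 \<Longrightarrow> (\<lambda>a b c. f a b c + g a b c) \<in> V31"
  by (simp add: V31_iff scale_right_distrib)

lemma hochschild_d2_eq: "hochschild_d2 x y a b c = - (beta x y a b c + beta y x a b c)"
  by (simp add: hochschild_d2_def beta_def)

text \<open>Expanding the inner product in the basis and using linearity of the outer product
  \<open>x\<close> turns composition into the sum over \<open>l\<close> in
  \<open>bform\<close>.\<close>

lemma crd_beta:
  assumes "x \<in> V21"
  shows "crd m (beta x y (e i) (e j) (e k)) = bform n (sconst x) (sconst y) i j k m"
proof -
  have lin: "Vector_Spaces.linear scale scale (\<lambda>a. x a b)"
    "Vector_Spaces.linear scale scale (x a)" for a b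
    using assms by (auto simp: V21_def)
  have left: "crd m (x v (e k)) = (\<Sum>l<n. crd l v * crd m (x (e l) (e k)))" for v
    using arg_cong[OF linear_expansion[OF lin(1)[of "e k"], of v], of "crd m"]
    by (simp only: crd_sum crd_scale)
  have right: "crd m (x (e i) v) = (\<Sum>l<n. crd l v * crd m (x (e i) (e l)))" for v
    using arg_cong[OF linear_expansion[OF lin(2)[of "e i"], of v], of "crd m"]
    by (simp only: crd_sum crd_scale)
  show ?thesis
    by (simp add: beta_def crd_diff bform_def sconst_eq_crd left[of "y (e i) (e j)"]
        right[of "y (e j) (e k)"] mult.commute)
qed

lemma Alg_bform:
  assumes "x \<in> Alg"
  shows "bform n (sconst x) (sconst x) i j k m = 0"
proof -
  have "x \<in> V21" and "beta x x (e i) (e j) (e k) = 0"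
    using assms by (simp_all add: Alg_def Phi_def beta_def)
  then show ?thesis
    by (metis crd_beta crd_0)
qed

text \<open>The sum of \<open>beta x y\<close> and \<open>beta y x\<close> is trilinear, so it is
  zero as soon as all its coordinates on basis triples are, and these are the polarizations by
  \<open>crd_beta\<close>.\<close>

lemma Z2_iff_bform:
  assumes x: "x \<in> V21" and y: "y \<in> V21"
  shows "y \<in> Z2 x \<longleftrightarrow> (\<forall>i<n. \<forall>j<n. \<forall>k<n. \<forall>m<n.
    bform n (sconst x) (sconst y) i j k m + bform n (sconst y) (sconst x) i j k m = 0)"
    (is "_ \<longleftrightarrow> ?R")
proof -
  let ?f = "\<lambda>a b c. beta x y a b c + beta y x a b c"
  have f: "?f \<in> V31"
    by (intro V31_add beta_in_V31 x y)
  have crd: "crd m (?f (e i) (e j) (e k)) =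
    bform n (sconst x) (sconst y) i j k m + bform n (sconst y) (sconst x) i j k m" for i j k m
    by (simp add: crd_add crd_beta x y)
  have "y \<in> Z2 x \<longleftrightarrow> (\<forall>a b c. ?f a b c = 0)"
    using y by (simp add: Z2_def hochschild_d2_eq neg_eq_iff_add_eq_0 flip: minus_add_distrib)
  also have "\<dots> \<longleftrightarrow> ?R"
  proof
    assume "\<forall>a b c. ?f a b c = 0"
    then show ?R
      by (metis crd crd_0)
  next
    assume R: ?R
    have "?f (e i) (e j) (e k) = 0" if "i < n" "j < n" "k < n" for i j k
      by (rule crd_eq_0_imp_eq_0) (use R crd that in simp)
    then show "\<forall>a b c. ?f a b c = 0"
      using trilinear_eq_0[OF f] by blast
  qed
  finally show ?thesis .
qed

text \<open>The coordinates of a tangent functional solve the polarized equations. Conversely, for a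
  cocycle \<open>y\<close> the derivative at \<open>x\<close> in the direction \<open>y\<close> is
  such a functional, and its value on X_v - x_v is the structure constant of \<open>y\<close> at
  \<open>v\<close>.\<close>

lemma tangent_space_eq_Z2:
  assumes "x \<in> Alg"
  shows "tangent_space x = Z2 x"
proof -
  have x: "x \<in> V21"
    using assms by (simp add: Alg_def)
  have "y \<in> tangent_space x \<longleftrightarrow> y \<in> Z2 x" if y: "y \<in> V21" for y
  proof
    assume "y \<in> tangent_space x"
    then obtain t where "t \<in> cotangent_dual n (sconst x)"
      and "\<And>v. v \<in> idx n \<Longrightarrow> sconst y v = t (shifted_var (sconst x) v)"
      by (auto simp: tangent_space_def shifted_var_def)
    then show "y \<in> Z2 x"
      unfolding Z2_iff_bform[OF x y]
      using cotangent_dual_bform[OF _ Alg_bform[OF assms]] by blast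
  next
    assume "y \<in> Z2 x"
    then have "dir_deriv (sconst x) (sconst y) \<in> cotangent_dual n (sconst x)"
      by (intro dir_deriv_cotangent_dual) (simp_all add: Z2_iff_bform x y Alg_bform assms)
    then show "y \<in> tangent_space x"
      unfolding tangent_space_def using y
      by (auto intro!: bexI simp: dir_deriv_diff dir_deriv_pvar dir_deriv_pconst)
  qed
  moreover have "tangent_space x \<subseteq> V21" "Z2 x \<subseteq> V21"
    by (auto simp: tangent_space_def Z2_def)
  ultimately show ?thesis
    by blast
qed

section \<open>The incidence fiber\<close>

lemma module_matrix: "module (\<lambda>(c :: 'k) (q :: idx3 \<Rightarrow> idx3 \<Rightarrow> 'k) u v. c * q u v)"
  by unfold_locales (auto simp: fun_eq_iff algebra_simps)

lemma mspan_base: "q \<in> S \<Longrightarrow> q \<in> mspan S"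
  unfolding mspan_def by (rule module.span_base[OF module_matrix])

text \<open>The kernel of the linear functional \<open>L\<close> is a subspace containing
  \<open>S\<close>, hence contains its span.\<close>

lemma mspan_vanishing:
  assumes "\<And>q. q \<in> S \<Longrightarrow> L q = 0" and "q \<in> mspan S"
    and add: "\<And>q r. L (\<lambda>u v. q u v + r u v) = L q + L r"
    and scale: "\<And>c q. L (\<lambda>u v. c * q u v) = c * L q"
  shows "L q = (0 :: 'k)"
proof -
  have zero: "L 0 = 0"
    using scale[of 0 0] by (simp add: zero_fun_def)
  have "module.subspace (\<lambda>c q u v. c * q u v) {q. L q = 0}"
    unfolding module.subspace_def[OF module_matrix] using zero add scale by (simp add: plus_fun_def)
  moreover have "S \<subseteq> {q. L q = 0}"
    using assms(1) by auto
  ultimately have "mspan S \<subseteq> {q. L q = 0}"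
    unfolding mspan_def by (rule module.span_minimal[OF module_matrix, rotated])
  then show ?thesis
    using assms(2) by auto
qed

lemma mform_add: "mform (\<lambda>u v. q u v + r u v) x y = mform q x y + mform r x y"
  by (simp add: mform_def algebra_simps sum.distrib)

lemma mform_diff: "mform (\<lambda>u v. q u v - r u v) x y = mform q x y - mform r x y"
  by (simp add: mform_def algebra_simps sum_subtractf)

lemma mform_scale: "mform (\<lambda>u v. c * q u v) x y = c * mform q x y"
  by (simp add: mform_def sum_distrib_left ac_simps)

lemma mform_sum: "mform (\<lambda>u v. \<Sum>l\<in>A. q l u v) x y = (\<Sum>l\<in>A. mform (q l) x y)"
proof (induction A rule: infinite_finite_induct)
  case (insert l A)
  then show ?case by (simp add: mform_add)
qed (simp_all add: mform_def)

lemma mform_transpose: "mform (\<lambda>u v. q v u) x y = mform q y x"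
  unfolding mform_def by (subst sum.swap) (simp add: ac_simps)

lemma finite_idx: "finite (idx n)"
  by (simp add: idx_def)

text \<open>A matrix unit extracts a single product of structure constants; sums of these build the
  matrices of the coordinate functionals.\<close>

lemma mform_unit:
  assumes "p \<in> idx n" "r \<in> idx n"
  shows "mform (\<lambda>u v. if u = p \<and> v = r then 1 else 0) x y = sconst x p * sconst y r"
proof -
  have "mform (\<lambda>u v. if u = p \<and> v = r then 1 else 0) x y =
      (\<Sum>u\<in>idx n. if u = p then (\<Sum>v\<in>idx n. if v = r then sconst x p * sconst y r else 0) else 0)"
    unfolding mform_def by (intro sum.cong refl) (auto intro!: sum.cong)
  then show ?thesis
    using assms finite_idx by simp
qed

text \<open>Pairing \<open>x\<close> and \<open>y\<close> through (q + q^t)/2 gives half of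
  \<open>mform q x y + mform q y x\<close>. This is linear in \<open>q\<close>, so passing to the
  two spans adds no condition beyond those on the generators.\<close>

lemma sym_fiber_iff:
  "(\<forall>q\<in>Q_As_sym. mform q x y = 0) \<longleftrightarrow>
    (\<forall>\<phi>\<in>V31_dual. \<forall>q. is_q \<phi> q \<longrightarrow> mform q x y + mform q y x = 0)"
proof
  assume L: "\<forall>q\<in>Q_As_sym. mform q x y = 0"
  show "\<forall>\<phi>\<in>V31_dual. \<forall>q. is_q \<phi> q \<longrightarrow> mform q x y + mform q y x = 0"
  proof (intro ballI allI impI)
    fix \<phi> q assume "\<phi> \<in> V31_dual" "is_q \<phi> q"
    then have "q \<in> Q_As"
      unfolding Q_As_def by (intro mspan_base) blast
    then have "(\<lambda>u v. 1 / 2 * (q u v + q v u)) \<in> Q_As_sym"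
      unfolding Q_As_sym_def by (intro mspan_base) blast
    then have "mform (\<lambda>u v. 1 / 2 * (q u v + q v u)) x y = 0"
      using L by blast
    then have "1 / 2 * (mform q x y + mform q y x) = 0"
      unfolding mform_scale mform_add mform_transpose[of q x y] .
    \<comment> \<open>The factor 1/2 cancels because the characteristic is 0.\<close>
    then show "mform q x y + mform q y x = 0" by simp
  qed
next
  assume R: "\<forall>\<phi>\<in>V31_dual. \<forall>q. is_q \<phi> q \<longrightarrow> mform q x y + mform q y x = 0"
  have *: "mform q x y + mform q y x = 0" if "q \<in> Q_As" for q
    by (rule mspan_vanishing[where L = "\<lambda>q. mform q x y + mform q y x",
          OF _ that[unfolded Q_As_def]])
      (use R in \<open>auto simp: mform_add mform_scale algebra_simps\<close>)
  have sym: "mform (\<lambda>u v. 1 / 2 * (q u v + q v u)) x y = 0" if "q \<in> Q_As" for q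
    unfolding mform_scale mform_add mform_transpose[of q x y] using *[OF that] by simp
  have "mform q x y = 0" if "q \<in> Q_As_sym" for q
    by (rule mspan_vanishing[where L = "\<lambda>q. mform q x y", OF _ that[unfolded Q_As_sym_def]])
      (use sym in \<open>auto simp only: mform_add mform_scale\<close>)
  then show "\<forall>q\<in>Q_As_sym. mform q x y = 0" ..
qed

lemma is_q_coordinate:
  assumes [simp]: "i < n" "j < n" "k < n" "m < n"
  shows "\<exists>q. is_q (\<lambda>f. crd m (f (e i) (e j) (e k))) q"
proof -
  \<comment> \<open>One matrix unit for each product occurring in \<open>bform\<close>. A difference
    of sums, not a case distinction, is used because the two families meet when i = j = k, where the
    common entry has to cancel.\<close>
  define q :: "idx3 \<Rightarrow> idx3 \<Rightarrow> 'k" where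
    "q = (\<lambda>u v. (\<Sum>l<n. if u = (l, k, m) \<and> v = (i, j, l) then 1 else 0)
              - (\<Sum>l<n. if u = (i, l, m) \<and> v = (j, k, l) then 1 else 0))"
  have mem: "(p, q, r) \<in> idx n \<longleftrightarrow> p < n \<and> q < n \<and> r < n" for p q r
    by (simp add: idx_def)
  have "mform q x y = bform n (sconst x) (sconst y) i j k m" for x y
    unfolding q_def mform_diff mform_sum bform_def by (simp add: mform_unit mem)
  moreover have "q u v = 0" if "u \<notin> idx n \<or> v \<notin> idx n" for u v
  proof -
    have "(\<Sum>l<n. if u = (l, k, m) \<and> v = (i, j, l) then 1 else 0 :: 'k) = 0"
      "(\<Sum>l<n. if u = (i, l, m) \<and> v = (j, k, l) then 1 else 0 :: 'k) = 0"
      by (rule sum.neutral; use that in \<open>auto simp: mem\<close>)+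
    then show ?thesis by (simp add: q_def)
  qed
  ultimately have "is_q (\<lambda>f. crd m (f (e i) (e j) (e k))) q"
    by (simp add: is_q_def crd_beta)
  then show ?thesis by blast
qed

lemma V31_dual_add_eq_0:
  assumes "\<phi> \<in> V31_dual" "f \<in> V31" "g \<in> V31" and "\<And>a b c. f a b c + g a b c = 0"
  shows "\<phi> f + \<phi> g = 0"
proof -
  have lin: "\<phi> (\<lambda>a b c. scale s (f a b c) + scale t (g a b c)) = s * \<phi> f + t * \<phi> g" for s t
    using assms(1-3) by (simp add: V31_dual_def)
  show ?thesis
    \<comment> \<open>The combinations with coefficients 1, 1 and 0, 0 are both the zero map, so
      \<phi> takes the same value on them, and the second value is 0.\<close>
    using lin[of 1 1] lin[of 0 0] assms(4) by simp
qed

text \<open>A point of the fiber is tested against the coordinate functionals of $V^{3,1}$, which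
  give the polarizations one by one. For a cocycle, every functional sends \<open>beta x y\<close>
  and \<open>beta y x\<close> to values with sum 0.\<close>

lemma incidence_fiber_eq_Z2:
  assumes x: "x \<in> V21"
  shows "incidence_fiber x = Z2 x"
proof -
  have "y \<in> incidence_fiber x \<longleftrightarrow> y \<in> Z2 x" if y: "y \<in> V21" for y
  proof
    assume "y \<in> incidence_fiber x"
    then have F: "mform q x y + mform q y x = 0" if "\<phi> \<in> V31_dual" "is_q \<phi> q" for \<phi> q
      using that sym_fiber_iff[of x y] by (auto simp: incidence_fiber_def)
    show "y \<in> Z2 x"
      unfolding Z2_iff_bform[OF x y]
    proof (intro allI impI)
      fix i j k m assume "i < n" "j < n" "k < n" "m < n"
      let ?\<phi> = "\<lambda>f. crd m (f (e i) (e j) (e k))"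
      obtain q where q: "is_q ?\<phi> q"
        using is_q_coordinate \<open>i < n\<close> \<open>j < n\<close> \<open>k < n\<close> \<open>m < n\<close> by blast
      have "?\<phi> \<in> V31_dual"
        by (simp add: V31_dual_def crd_add crd_scale)
      then have "mform q x y + mform q y x = 0"
        using F q by blast
      moreover have "?\<phi> (beta x y) = mform q x y" "?\<phi> (beta y x) = mform q y x"
        using q x y unfolding is_q_def by blast+
      ultimately show
        "bform n (sconst x) (sconst y) i j k m + bform n (sconst y) (sconst x) i j k m = 0"
        by (simp add: crd_beta x y)
    qed
  next
    assume "y \<in> Z2 x"
    then have "beta x y a b c + beta y x a b c = 0" for a b c
      unfolding Z2_def hochschild_d2_eq neg_equal_0_iff_equal by blast
    then have "mform q x y + mform q y x = 0" if "\<phi> \<in> V31_dual" "is_q \<phi> q" for \<phi> q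
      using V31_dual_add_eq_0[OF that(1) beta_in_V31[OF x y] beta_in_V31[OF y x]] that(2) x y
      by (auto simp: is_q_def)
    then show "y \<in> incidence_fiber x"
      using y sym_fiber_iff[of x y] by (auto simp: incidence_fiber_def)
  qed
  moreover have "incidence_fiber x \<subseteq> V21" "Z2 x \<subseteq> V21"
    by (auto simp: incidence_fiber_def Z2_def)
  ultimately show ?thesis
    by blast
qed

end

theorem proposition1p4:
  fixes scale :: "'k::field_char_0 \<Rightarrow> 'v::ab_group_add \<Rightarrow> 'v"
    and n :: nat and e :: "nat \<Rightarrow> 'v"
    and x :: "'v \<Rightarrow> 'v \<Rightarrow> 'v"
  assumes "based_vector_space scale n e"
    and "x \<in> based_vector_space.Alg scale"
  shows "based_vector_space.tangent_space scale n e x =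
           based_vector_space.incidence_fiber scale n e x \<and>
         based_vector_space.incidence_fiber scale n e x = based_vector_space.Z2 scale x"
proof -
  interpret based_vector_space scale n e by fact
  have "x \<in> V21"
    using assms(2) by (simp add: Alg_def)
  then show ?thesis
    using tangent_space_eq_Z2[OF assms(2)] incidence_fiber_eq_Z2 by simp
qed

end
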